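(* Let $d\ge 1$ and let $\mathbb{T}=(T_{ij})$ be a $d\times d$ operator matrix where $T_{ij}\in\mathcal{B}_A(\mathcal{H})$ for all $i,j\in\{1,\dots,d\}$, regarded as an operator on $\mathbb{H}=\oplus_{i=1}^d\mathcal{H}$. Then $$\omega_{\mathbb{A}}(\mathbb{T})\leq \frac{1}{2}\sum_{i=1}^d\omega_A(T_{ii})+\frac{1}{4}\left(d+\sum_{i,j=1}^{d}\|T_{ij}\|_A^2\right).$$
   Context: $(\mathcal{H},\langle\cdot\mid\cdot\rangle)$ is a non-trivial complex Hilbert space, $\mathcal{B}(\mathcal{H})$ is the algebra of bounded linear operators on $\mathcal{H}$, and $A\in\mathcal{B}(\mathcal{H})$ is a fixed nonzero positive (semidefinite) operator. Put $\langle x\mid y\rangle_A=\langle Ax\mid y\rangle$ and $\|x\|_A=\langle x\mid x\rangle_A^{1/2}$. An operator $T\in\mathcal{B}(\mathcal{H})$ is $A$-bounded, written $T\in\mathcal{B}_{A^{1/2}}(\mathcal{H})$, if there is $\lambda>0$ with $\|Tx\|_A\le\lambda\|x\|_A$ for all $x\in\mathcal{H}$. For such $T$, $\|T\|_A=\sup\{\|Tx\|_A : x\in\mathcal{H},\ \|x\|_A=1\}$ and the $A$-numerical radius is $\omega_A(T)=\sup\{|\langle Tx\mid x\rangle_A| : x\in\mathcal{H},\ \|x\|_A=1\}$. $\mathcal{B}_A(\mathcal{H})$ is the set of $T\in\mathcal{B}(\mathcal{H})$ for which the equation $AX=T^*A$ has a solution $X\in\mathcal{B}(\mathcal{H})$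 (equivalently $\mathcal{R}(T^*A)\subset\mathcal{R}(A)$, where $\mathcal{R}$ denotes range); one has $\mathcal{B}_A(\mathcal{H})\subseteq\mathcal{B}_{A^{1/2}}(\mathcal{H})$. $\mathbb{H}=\oplus_{i=1}^d\mathcal{H}$ has the inner product $\langle x,y\rangle=\sum_{k=1}^d\langle x_k\mid y_k\rangle$, and $\mathbb{A}$ is the $d\times d$ diagonal operator matrix on $\mathbb{H}$ with every diagonal entry equal to $A$. $\omega_{\mathbb{A}}$ is the notion above with $(\mathbb{H},\mathbb{A})$ in place of $(\mathcal{H},A)$. *)

theory Defs
  imports "HOL-Analysis.Analysis"
begin

class complex_vector = real_vector +
  fixes scaleC :: "complex \<Rightarrow> 'a \<Rightarrow> 'a" (infixr \<open>*\<^sub>C\<close> 75)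
  assumes scaleC_add_right: "c *\<^sub>C (x + y) = c *\<^sub>C x + c *\<^sub>C y"
    and scaleC_add_left: "(b + c) *\<^sub>C x = b *\<^sub>C x + c *\<^sub>C x"
    and scaleC_scaleC: "b *\<^sub>C c *\<^sub>C x = (b * c) *\<^sub>C x"
    and scaleR_scaleC: "r *\<^sub>R x = complex_of_real r *\<^sub>C x"

text \<open>The inner product is linear in its first argument. Positive definiteness and
  the norm come from \<^class>\<open>real_inner\<close>, whose inner product is the real part of the complex one.\<close>

class complex_inner = complex_vector + real_inner +
  fixes cinner :: "'a \<Rightarrow> 'a \<Rightarrow> complex"
  assumes cinner_commute: "cinner x y = cnj (cinner y x)"
    and cinner_add_left: "cinner (x + y) z = cinner x z + cinner y z"
    and cinner_scaleC_left: "cinner (c *\<^sub>C x) y = c * cinner x y"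
    and inner_eq_Re_cinner: "inner x y = Re (cinner x y)"

class chilbert_space = complex_inner + complete_space

instantiation vec :: (complex_vector, finite) complex_vector
begin
definition "scaleC c x = (\<chi> i. c *\<^sub>C (x $ i))"
instance
  by standard (simp_all add: scaleC_vec_def vec_eq_iff scaleC_add_right scaleC_add_left
      scaleC_scaleC scaleR_scaleC)
end

instantiation vec :: (complex_inner, finite) complex_inner
begin
definition "cinner x y = (\<Sum>i\<in>UNIV. cinner (x $ i) (y $ i))"
instance
proof
  fix x y z :: "('a, 'b) vec" and c :: complex
  show "cinner x y = cnj (cinner y x)"
    unfolding cinner_vec_def cnj_sum by (rule sum.cong[OF refl], rule cinner_commute)
  show "cinner (x + y) z = cinner x z + cinner y z"
    by (simp add: cinner_vec_def cinner_add_left sum.distrib)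
  show "cinner (c *\<^sub>C x) y = c * cinner x y"
    by (simp add: cinner_vec_def scaleC_vec_def cinner_scaleC_left sum_distrib_left)
  show "inner x y = Re (cinner x y)"
    by (simp add: cinner_vec_def inner_vec_def inner_eq_Re_cinner)
qed
end

instance vec :: (chilbert_space, finite) chilbert_space ..

locale bounded_clinear = bounded_linear T
  for T :: "'a::complex_inner \<Rightarrow> 'b::complex_inner" +
  assumes scaleC: "T (c *\<^sub>C x) = c *\<^sub>C T x"

definition cadjoint :: "('a::chilbert_space \<Rightarrow> 'a) \<Rightarrow> 'a \<Rightarrow> 'a" where
  "cadjoint T = (THE S. \<forall>x y. cinner (T x) y = cinner x (S y))"

text \<open>Riesz representation shows that this description is meaningful for bounded operators.\<close>

lemma riesz_real:
  fixes g :: "'a::{real_inner, complete_space} \<Rightarrow> real"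
  assumes "bounded_linear g"
  shows "\<exists>r. \<forall>x. g x = inner x r"
proof -
  interpret g: bounded_linear g by fact
  obtain K where K: "\<And>x. norm (g x) \<le> norm x * K" using g.bounded by blast
  define \<phi> where "\<phi> = (\<lambda>x. (norm x)\<^sup>2 - 2 * g x)"
  have low: "- (K\<^sup>2) \<le> \<phi> x" for x
  proof -
    have "0 \<le> (norm x - K)\<^sup>2" by simp
    moreover have "g x \<le> norm x * K" using K[of x] by simp
    ultimately show ?thesis unfolding \<phi>_def power2_diff by (simp add: algebra_simps)
  qed
  define m where "m = Inf (range \<phi>)"
  have bdd: "bdd_below (range \<phi>)" unfolding bdd_below_def using low by blast
  have m: "m \<le> \<phi> x" for x unfolding m_def by (rule cInf_lower[OF _ bdd]) simp
  have "\<exists>x. \<phi> x < m + inverse (real (Suc n))" for n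
  proof -
    have "Inf (range \<phi>) < m + inverse (real (Suc n))" unfolding m_def by simp
    then show ?thesis using cInf_lessD[of "range \<phi>"] by blast
  qed
  then obtain X where X: "\<And>n. \<phi> (X n) < m + inverse (real (Suc n))" by metis
  have par: "(norm (x - y))\<^sup>2 \<le> 2 * (\<phi> x - m) + 2 * (\<phi> y - m)" for x y
  proof -
    have "(norm (x - y))\<^sup>2 = 2 * \<phi> x + 2 * \<phi> y - 4 * \<phi> ((1/2) *\<^sub>R (x + y))"
      unfolding \<phi>_def g.scaleR g.add power2_norm_eq_inner
      by (simp add: algebra_simps inner_commute)
    also have "\<dots> \<le> 2 * \<phi> x + 2 * \<phi> y - 4 * m"
      by (intro diff_left_mono mult_left_mono m) simp
    finally show ?thesis by simp
  qed
  have "Cauchy X"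
  proof (rule metric_CauchyI)
    fix e :: real assume e: "0 < e"
    then obtain N where N: "inverse (real (Suc N)) < e\<^sup>2 / 4"
      using reals_Archimedean[of "e\<^sup>2 / 4"] by auto
    have "dist (X i) (X j) < e" if "i \<ge> N" "j \<ge> N" for i j
    proof -
      have *: "\<phi> (X k) - m < e\<^sup>2 / 4" if "k \<ge> N" for k
      proof -
        have "inverse (real (Suc k)) \<le> inverse (real (Suc N))"
          using that by (simp add: field_simps)
        then show ?thesis using X[of k] N by linarith
      qed
      have "(norm (X i - X j))\<^sup>2 < e\<^sup>2" using par[of "X i" "X j"] *[OF that(1)] *[OF that(2)]
        by argo
      then show ?thesis using e by (simp add: dist_norm power_less_imp_less_base)
    qed
    then show "\<exists>M. \<forall>i\<ge>M. \<forall>j\<ge>M. dist (X i) (X j) < e" by blast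
  qed
  then obtain r where r: "X \<longlonglongrightarrow> r" using Cauchy_convergent convergent_def by blast
  have "(\<lambda>n. \<phi> (X n)) \<longlonglongrightarrow> \<phi> r" unfolding \<phi>_def
    by (intro tendsto_intros r g.tendsto)
  moreover have "(\<lambda>n. m + inverse (real (Suc n))) \<longlonglongrightarrow> m + 0"
    by (intro tendsto_intros LIMSEQ_inverse_real_of_nat)
  ultimately have "\<phi> r \<le> m"
    using X by (intro LIMSEQ_le[of _ "\<phi> r" _ m]) (auto intro: less_imp_le)
  then have min: "\<phi> r \<le> \<phi> x" for x using m[of x] by linarith
  have "g h = inner h r" for h
  proof (rule ccontr)
    assume ne: "g h \<noteq> inner h r"
    define a where "a = inner h r - g h"
    have h: "inner h h > 0" using ne by (auto simp: g.zero)
    define t where "t = - a / inner h h"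
    have "\<phi> (r + t *\<^sub>R h) - \<phi> r = 2 * t * a + t\<^sup>2 * inner h h"
      unfolding \<phi>_def a_def g.add g.scaleR power2_norm_eq_inner
      by (simp add: algebra_simps inner_commute power2_eq_square)
    also have "\<dots> = - (a\<^sup>2 / inner h h)"
      using h by (simp add: t_def field_simps power2_eq_square)
    also have "\<dots> < 0" using h ne by (simp add: a_def)
    finally show False using min[of "r + t *\<^sub>R h"] by linarith
  qed
  then show ?thesis by blast
qed

lemma cinner_eq_of_Re:
  fixes x :: "'a::complex_inner"
  assumes lin: "\<And>c x. f (c *\<^sub>C x) = c * f x" and Re: "\<And>x. Re (f x) = Re (cinner x r)"
  shows "f x = cinner x r"
  using Re[of x] Re[of "\<i> *\<^sub>C x"] by (simp add: lin cinner_scaleC_left complex_eq_iff)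

lemma cadjoint_exists:
  fixes T :: "'a::chilbert_space \<Rightarrow> 'a"
  assumes "bounded_clinear T"
  shows "\<exists>!S. \<forall>x y. cinner (T x) y = cinner x (S y)"
proof -
  interpret bounded_clinear T by fact
  have "\<exists>r. \<forall>x. cinner (T x) y = cinner x r" for y
  proof -
    have "bounded_linear (\<lambda>x. inner (T x) y)"
      by (rule bounded_linear_compose[OF bounded_linear_inner_left]) (rule bounded_linear_axioms)
    from riesz_real[OF this] obtain r where "\<And>x. inner (T x) y = inner x r" by blast
    then have "cinner (T x) y = cinner x r" for x
      by (intro cinner_eq_of_Re) (simp_all add: scaleC cinner_scaleC_left inner_eq_Re_cinner)
    then show ?thesis by blast
  qed
  then obtain S where S: "\<forall>x y. cinner (T x) y = cinner x (S y)" by metis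
  moreover have "S' = S" if "\<forall>x y. cinner (T x) y = cinner x (S' y)" for S'
  proof
    fix y
    have "inner x (S' y) = inner x (S y)" for x
      using that S by (simp add: inner_eq_Re_cinner)
    then show "S' y = S y" by (metis inner_commute vector_eq_ldot)
  qed
  ultimately show ?thesis by blast
qed

lemma cadjoint:
  fixes T :: "'a::chilbert_space \<Rightarrow> 'a"
  assumes "bounded_clinear T"
  shows "cinner (T x) y = cinner x (cadjoint T y)"
  using theI'[OF cadjoint_exists[OF assms]] unfolding cadjoint_def by blast

definition positive_op :: "('a::chilbert_space \<Rightarrow> 'a) \<Rightarrow> bool" where
  "positive_op A \<longleftrightarrow> bounded_clinear A \<and> (\<forall>x. cinner (A x) x \<in> \<real>\<^sub>\<ge>\<^sub>0)"

definition A_inner :: "('a::chilbert_space \<Rightarrow> 'a) \<Rightarrow> 'a \<Rightarrow> 'a \<Rightarrow> complex" where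
  "A_inner A x y = cinner (A x) y"

definition A_norm :: "('a::chilbert_space \<Rightarrow> 'a) \<Rightarrow> 'a \<Rightarrow> real" where
  "A_norm A x = sqrt (Re (A_inner A x x))"

text \<open>The suprema below are real-valued, hence only meaningful for operators \<open>T\<close> that are bounded
  with respect to the seminorm \<^term>\<open>A_norm A\<close> and for nonzero positive \<open>A\<close>.\<close>

definition A_bounded :: "('a::chilbert_space \<Rightarrow> 'a) \<Rightarrow> ('a \<Rightarrow> 'a) set" where
  "A_bounded A = {T. bounded_clinear T \<and> (\<exists>c>0. \<forall>x. A_norm A (T x) \<le> c * A_norm A x)}"

definition A_opnorm :: "('a::chilbert_space \<Rightarrow> 'a) \<Rightarrow> ('a \<Rightarrow> 'a) \<Rightarrow> real" where
  "A_opnorm A T = Sup {A_norm A (T x) | x. A_norm A x = 1}"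

definition A_numradius :: "('a::chilbert_space \<Rightarrow> 'a) \<Rightarrow> ('a \<Rightarrow> 'a) \<Rightarrow> real" where
  "A_numradius A T = Sup {cmod (A_inner A (T x) x) | x. A_norm A x = 1}"

text \<open>Solvability of \<open>A X = T\<^sup>* A\<close>. For positive \<open>A\<close> this is a subset of \<^term>\<open>A_bounded A\<close>.\<close>

definition A_adjointable :: "('a::chilbert_space \<Rightarrow> 'a) \<Rightarrow> ('a \<Rightarrow> 'a) set" where
  "A_adjointable A =
    {T. bounded_clinear T \<and> (\<exists>X. bounded_clinear X \<and> A \<circ> X = cadjoint T \<circ> A)}"

definition op_matrix :: "('n::finite \<Rightarrow> 'n \<Rightarrow> 'a::chilbert_space \<Rightarrow> 'a) \<Rightarrow> 'a ^ 'n \<Rightarrow> 'a ^ 'n" where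
  "op_matrix T x = (\<chi> i. \<Sum>j\<in>UNIV. T i j (x $ j))"

definition diag_op :: "('a::chilbert_space \<Rightarrow> 'a) \<Rightarrow> 'a ^ 'n::finite \<Rightarrow> 'a ^ 'n" where
  "diag_op A = op_matrix (\<lambda>i j. if i = j then A else (\<lambda>_. 0))"

end

theory Submission
  imports Defs
begin

text \<open>
  Write \<open>a i\<close> for the seminorm of the \<open>i\<close>-th component of a vector \<open>x\<close> with
  \<open>(\<Sum>i. (a i)\<^sup>2) = 1\<close>. Expanding the quadratic form of the operator matrix at \<open>x\<close>, and estimating
  the diagonal terms by the numerical radii \<open>w i\<close> and the other terms by the operator seminorms
  \<open>n i j\<close>, bounds it by
  \<open>\<Sum>i. w i * (a i)\<^sup>2 + (\<Sum>j\<noteq>i. n i j * a i * a j)\<close>.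
  The theorem already holds for each row of this sum separately. Indeed \<open>u * v \<le> u\<^sup>2 / 4 + v\<^sup>2\<close>
  applies both to \<open>n i j * (a i * a j)\<close> and to \<open>w i * ((a i)\<^sup>2 - 1 / 2)\<close>; as \<open>w i \<le> n i i\<close>, the
  first squares give \<open>(\<Sum>j. (n i j)\<^sup>2) / 4\<close>, and the second squares add up to exactly \<open>1 / 4\<close>
  because \<open>(\<Sum>j\<noteq>i. (a j)\<^sup>2) = 1 - (a i)\<^sup>2\<close> (\<open>row_estimate\<close>).

  The numerical radii and operator seminorms are real suprema, which bound the individual values
  only if these are bounded. So the analytic part of the proof is that every operator with an
  \<open>A\<close>-adjoint is bounded for the seminorm of \<open>A\<close> (\<open>A_adjointable_imp_A_bounded\<close>). If \<open>A X = T\<^sup>* A\<close>,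
  then \<open>S = X T\<close> is symmetric for the semi-inner product of \<open>A\<close>, and \<open>\<parallel>T x\<parallel>\<^sup>2 = \<langle>S x | x\<rangle>\<close>
  in that semi-inner product. For a symmetric operator the seminorms of the iterates \<open>S\<^sup>n x\<close>
  form a log-convex sequence. Since they grow at most like \<open>K\<^sup>n\<close>, where \<open>K\<close> bounds \<open>S\<close> in the
  Hilbert space norm, their first ratio is at most \<open>K\<close>.
\<close>

section \<open>The semi-inner product of a positive operator\<close>

lemma cinner_add_right: "cinner x (y + z) = cinner x y + cinner x z"
  by (metis cinner_add_left cinner_commute complex_cnj_add)

lemma cinner_scaleC_right: "cinner x (c *\<^sub>C y) = cnj c * cinner x y"
  by (metis cinner_scaleC_left cinner_commute complex_cnj_mult)

lemma cinner_zero_left [simp]: "cinner 0 y = 0"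
  using cinner_add_left[of 0 0 y] by simp

lemma cinner_zero_right [simp]: "cinner x 0 = 0"
  using cinner_add_right[of x 0 0] by simp

lemma cinner_sum_left: "cinner (sum f I) y = (\<Sum>i\<in>I. cinner (f i) y)"
  by (induction I rule: infinite_finite_induct) (simp_all add: cinner_add_left)

lemma A_inner_add_left:
  assumes "positive_op A" shows "A_inner A (x + y) z = A_inner A x z + A_inner A y z"
proof -
  interpret bounded_clinear A using assms by (simp add: positive_op_def)
  show ?thesis by (simp add: A_inner_def add cinner_add_left)
qed

lemma A_inner_scaleC_left:
  assumes "positive_op A" shows "A_inner A (c *\<^sub>C x) y = c * A_inner A x y"
proof -
  interpret bounded_clinear A using assms by (simp add: positive_op_def)
  show ?thesis by (simp add: A_inner_def scaleC cinner_scaleC_left)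
qed

lemma A_inner_add_right: "A_inner A x (y + z) = A_inner A x y + A_inner A x z"
  by (simp add: A_inner_def cinner_add_right)

lemma A_inner_scaleC_right: "A_inner A x (c *\<^sub>C y) = cnj c * A_inner A x y"
  by (simp add: A_inner_def cinner_scaleC_right)

lemma A_inner_sum_left:
  assumes "positive_op A"
  shows "A_inner A (sum f I) y = (\<Sum>i\<in>I. A_inner A (f i) y)"
proof -
  interpret bounded_clinear A using assms by (simp add: positive_op_def)
  show ?thesis by (simp add: A_inner_def sum cinner_sum_left)
qed

lemma A_inner_self:
  assumes "positive_op A"
  shows "A_inner A x x = complex_of_real ((A_norm A x)\<^sup>2)"
proof -
  have "A_inner A x x \<in> \<real>\<^sub>\<ge>\<^sub>0"
    using assms by (simp add: positive_op_def A_inner_def)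
  then show ?thesis
    by (auto simp: A_norm_def complex_nonneg_Reals_iff complex_eq_iff)
qed

lemma A_norm_nonneg:
  assumes "positive_op A" shows "0 \<le> A_norm A x"
proof -
  have "A_inner A x x \<in> \<real>\<^sub>\<ge>\<^sub>0"
    using assms by (simp add: positive_op_def A_inner_def)
  then show ?thesis by (simp add: A_norm_def complex_nonneg_Reals_iff)
qed

text \<open>Polarization: the form is real at \<open>x + y\<close> and at \<open>x + \<i> y\<close>, so the two mixed terms at \<open>x\<close>
  and \<open>y\<close> have opposite imaginary and equal real parts.\<close>

lemma A_inner_commute:
  assumes "positive_op A" shows "A_inner A y x = cnj (A_inner A x y)"
proof -
  have real: "Im (A_inner A z z) = 0" for z
    by (simp add: A_inner_self[OF assms])
  show ?thesis
    using real[of "x + y"] real[of "x + \<i> *\<^sub>C y"] real[of x] real[of y]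
    by (simp add: A_inner_add_left[OF assms] A_inner_add_right A_inner_scaleC_left[OF assms]
        A_inner_scaleC_right complex_eq_iff)
qed

lemma A_norm_scaleC:
  assumes "positive_op A" shows "A_norm A (c *\<^sub>C x) = cmod c * A_norm A x"
proof -
  have "of_real ((A_norm A (c *\<^sub>C x))\<^sup>2) = c * cnj c * A_inner A x x"
    by (simp add: A_inner_scaleC_left[OF assms] A_inner_scaleC_right
        del: of_real_power flip: A_inner_self[OF assms])
  also have "\<dots> = of_real ((cmod c * A_norm A x)\<^sup>2)"
    by (simp add: A_inner_self[OF assms] power_mult_distrib flip: complex_norm_square)
  finally have "(A_norm A (c *\<^sub>C x))\<^sup>2 = (cmod c * A_norm A x)\<^sup>2"
    unfolding of_real_eq_iff .
  then show ?thesis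
    by (simp add: A_norm_nonneg[OF assms] power2_eq_iff_nonneg)
qed

text \<open>The form may be degenerate, so a minimizing multiple of \<open>y\<close> need not exist. Nonnegativity of
  the form at \<open>x - t \<langle>x | y\<rangle> y\<close> for all real \<open>t\<close> covers the degenerate case as well.\<close>

lemma A_inner_Cauchy_Schwarz:
  assumes "positive_op A"
  shows "cmod (A_inner A x y) \<le> A_norm A x * A_norm A y"
proof -
  define s where "s = A_inner A x y"
  have quad: "0 \<le> (A_norm A x)\<^sup>2 - 2 * t * (cmod s)\<^sup>2 + t\<^sup>2 * (cmod s)\<^sup>2 * (A_norm A y)\<^sup>2" for t
  proof -
    define z where "z = x + (- of_real t * s) *\<^sub>C y"
    have "A_inner A z z = A_inner A x x - 2 * t * (s * cnj s)
        + t\<^sup>2 * (s * cnj s) * A_inner A y y"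
      by (simp add: z_def A_inner_add_left[OF assms] A_inner_add_right
          A_inner_scaleC_left[OF assms] A_inner_scaleC_right A_inner_commute[OF assms, of y x]
          flip: s_def)
         (simp add: algebra_simps power2_eq_square)
    also have "\<dots> = of_real ((A_norm A x)\<^sup>2 - 2 * t * (cmod s)\<^sup>2 + t\<^sup>2 * (cmod s)\<^sup>2 * (A_norm A y)\<^sup>2)"
      by (simp add: A_inner_self[OF assms] flip: complex_norm_square)
    finally have "(A_norm A z)\<^sup>2 = (A_norm A x)\<^sup>2 - 2 * t * (cmod s)\<^sup>2 + t\<^sup>2 * (cmod s)\<^sup>2 * (A_norm A y)\<^sup>2"
      unfolding A_inner_self[OF assms] of_real_eq_iff .
    then show ?thesis by (metis zero_le_power2)
  qed
  have "(cmod s)\<^sup>2 \<le> (A_norm A x * A_norm A y)\<^sup>2"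
  proof (cases "A_norm A y = 0")
    case True
    have "s = 0"
    proof (rule ccontr)
      assume "s \<noteq> 0"
      then show False
        using quad[of "((A_norm A x)\<^sup>2 + 1) / (2 * (cmod s)\<^sup>2)"] True by (simp add: field_simps)
    qed
    then show ?thesis by simp
  next
    case False
    then have "0 \<le> (A_norm A x)\<^sup>2 - (cmod s)\<^sup>2 / (A_norm A y)\<^sup>2"
      using quad[of "1 / (A_norm A y)\<^sup>2"] by (simp add: power2_eq_square)
    moreover have "0 < (A_norm A y)\<^sup>2" using False by simp
    ultimately show ?thesis by (simp add: field_simps)
  qed
  then show ?thesis
    unfolding s_def by (rule power2_le_imp_le) (simp add: A_norm_nonneg[OF assms])
qed

lemma A_norm_le_norm:
  assumes "positive_op A"
  obtains C where "\<And>x. A_norm A x \<le> C * norm x"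
proof -
  interpret bounded_clinear A using assms by (simp add: positive_op_def)
  obtain K where K: "0 < K" "\<And>x. norm (A x) \<le> norm x * K" using pos_bounded by blast
  have "A_norm A x \<le> sqrt K * norm x" for x
  proof -
    have "Re (A_inner A x x) \<le> norm (A x) * norm x"
      unfolding A_inner_def inner_eq_Re_cinner[symmetric] by (rule norm_cauchy_schwarz)
    also have "\<dots> \<le> K * (norm x)\<^sup>2"
      using mult_right_mono[OF K(2)[of x] norm_ge_zero[of x]]
      by (simp add: power2_eq_square mult_ac)
    finally have "A_norm A x \<le> sqrt (K * (norm x)\<^sup>2)"
      unfolding A_norm_def by (rule real_sqrt_le_mono)
    then show ?thesis by (simp add: real_sqrt_mult)
  qed
  then show ?thesis by (rule that)
qed

text \<open>This is what keeps the suprema over \<open>A\<close>-unit vectors from being suprema of the empty set.\<close>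

lemma A_unit_vector_exists:
  assumes "positive_op A" and "A \<noteq> (\<lambda>_. 0)"
  obtains u where "A_norm A u = 1"
proof -
  obtain v where v: "A v \<noteq> 0" using assms(2) by fastforce
  have "A_norm A v \<noteq> 0"
  proof
    assume "A_norm A v = 0"
    then have "A_inner A v (A v) = 0"
      using A_inner_Cauchy_Schwarz[OF assms(1), of v "A v"] by simp
    then have "inner (A v) (A v) = 0" by (simp add: A_inner_def inner_eq_Re_cinner)
    then show False using v by simp
  qed
  moreover have "0 \<le> A_norm A v" by (rule A_norm_nonneg[OF assms(1)])
  ultimately have "A_norm A (of_real (1 / A_norm A v) *\<^sub>C v) = 1"
    by (simp add: A_norm_scaleC[OF assms(1)] norm_divide)
  then show ?thesis by (rule that)
qed

section \<open>Boundedness of operators with an adjoint\<close>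

text \<open>By log-convexity the ratios \<open>u (n + 1) / u n\<close> increase, so \<open>u n \<ge> q\<^sup>n * u 0\<close> for the first
  ratio \<open>q\<close>. For \<open>q > K\<close> this would outgrow \<open>C * K\<^sup>n\<close>.\<close>

lemma log_convex_first_ratio_le:
  fixes u :: "nat \<Rightarrow> real"
  assumes nonneg: "\<And>n. 0 \<le> u n" and log_convex: "\<And>n. (u (Suc n))\<^sup>2 \<le> u n * u (Suc (Suc n))"
    and growth: "\<And>n. u n \<le> C * K ^ n" and "0 < K"
  shows "u 1 \<le> K * u 0"
proof (cases "u 0 = 0")
  case True
  then show ?thesis using log_convex[of 0] by simp
next
  case False
  then have pos: "0 < u 0" using nonneg[of 0] by simp
  define q where "q = u 1 / u 0"
  have q: "0 \<le> q" unfolding q_def using nonneg pos by simp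
  have ratio: "q * u n \<le> u (Suc n)" for n
  proof (induction n)
    case 0
    then show ?case using pos by (simp add: q_def)
  next
    case (Suc n)
    show ?case
    proof (cases "u (Suc n) = 0")
      case True
      then show ?thesis using nonneg by simp
    next
      case False
      then have "u n \<noteq> 0" using log_convex[of n] by auto
      then have n: "0 < u n" using nonneg[of n] by simp
      have "u n * (q * u (Suc n)) = (q * u n) * u (Suc n)" by simp
      also have "\<dots> \<le> u (Suc n) * u (Suc n)"
        by (rule mult_right_mono[OF Suc nonneg])
      also have "\<dots> \<le> u n * u (Suc (Suc n))"
        using log_convex[of n] by (simp add: power2_eq_square)
      finally show ?thesis using n by simp
    qed
  qed
  have power: "q ^ n * u 0 \<le> u n" for n
  proof (induction n)
    case (Suc n)
    have "q ^ Suc n * u 0 = q * (q ^ n * u 0)" by simp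
    also have "\<dots> \<le> q * u n" by (rule mult_left_mono[OF Suc q])
    finally show ?case using ratio[of n] by simp
  qed simp
  have "q \<le> K"
  proof (rule ccontr)
    assume "\<not> q \<le> K"
    then have "1 < q / K" using \<open>0 < K\<close> by simp
    then obtain n where "C / u 0 < (q / K) ^ n" using real_arch_pow by blast
    then have "C * K ^ n < q ^ n * u 0"
      using pos \<open>0 < K\<close> by (simp add: field_simps)
    then show False using power[of n] growth[of n] by simp
  qed
  then show ?thesis using pos by (simp add: q_def field_simps)
qed

text \<open>A symmetric operator that is bounded in the Hilbert space norm is bounded in the seminorm,
  with the same constant; the proof iterates the operator to remove the factor that compares
  the two norms.\<close>

lemma A_symmetric_bounded:
  assumes A: "positive_op A"
    and symmetric: "\<And>x y. A_inner A (S x) y = A_inner A x (S y)"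
    and bounded: "\<And>x. norm (S x) \<le> K * norm x" and "0 < K"
  shows "A_norm A (S x) \<le> K * A_norm A x"
proof -
  define u where "u n = A_norm A ((S ^^ n) x)" for n
  obtain C where C: "\<And>x. A_norm A x \<le> C * norm x" using A_norm_le_norm[OF A] by blast
  have "u 1 \<le> K * u 0"
  proof (rule log_convex_first_ratio_le)
    show "0 \<le> u n" for n by (simp add: u_def A_norm_nonneg[OF A])
    show "(u (Suc n))\<^sup>2 \<le> u n * u (Suc (Suc n))" for n
    proof -
      let ?y = "(S ^^ n) x"
      have "of_real ((u (Suc n))\<^sup>2) = A_inner A ?y (S (S ?y))"
        by (simp add: u_def symmetric del: of_real_power flip: A_inner_self[OF A])
      then have "(u (Suc n))\<^sup>2 = cmod (A_inner A ?y (S (S ?y)))"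
        by (metis norm_of_real abs_power2)
      also have "\<dots> \<le> A_norm A ?y * A_norm A (S (S ?y))"
        by (rule A_inner_Cauchy_Schwarz[OF A])
      finally show ?thesis by (simp add: u_def)
    qed
    show "u n \<le> (\<bar>C\<bar> * norm x) * K ^ n" for n
    proof -
      have iterate: "norm ((S ^^ n) x) \<le> K ^ n * norm x"
      proof (induction n)
        case (Suc n)
        have "norm ((S ^^ Suc n) x) \<le> K * norm ((S ^^ n) x)" using bounded by simp
        also have "\<dots> \<le> K * (K ^ n * norm x)"
          using Suc \<open>0 < K\<close> by (intro mult_left_mono) auto
        finally show ?case by (simp add: mult.assoc)
      qed simp
      have "u n \<le> C * norm ((S ^^ n) x)" unfolding u_def by (rule C)
      also have "\<dots> \<le> \<bar>C\<bar> * norm ((S ^^ n) x)" by (intro mult_right_mono) auto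
      also have "\<dots> \<le> \<bar>C\<bar> * (K ^ n * norm x)" by (intro mult_left_mono iterate) auto
      finally show ?thesis by (simp add: mult_ac)
    qed
  qed fact
  then show ?thesis by (simp add: u_def)
qed

text \<open>Apply the previous bound to \<open>S = X T\<close>, where \<open>X\<close> is an \<open>A\<close>-adjoint of \<open>T\<close>, so that
  \<open>A S = T\<^sup>* A T\<close>.\<close>

lemma A_adjointable_imp_A_bounded:
  assumes A: "positive_op A" and T: "T \<in> A_adjointable A"
  shows "T \<in> A_bounded A"
proof -
  have "bounded_clinear T" using T by (simp add: A_adjointable_def)
  then interpret T: bounded_clinear T .
  obtain X where X: "bounded_clinear X" and "A \<circ> X = cadjoint T \<circ> A"
    using T by (auto simp: A_adjointable_def)
  then have AX: "A (X x) = cadjoint T (A x)" for x by (metis comp_apply)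
  interpret X: bounded_clinear X by (rule X)
  define S where "S = X \<circ> T"
  have S_left: "A_inner A (S x) y = A_inner A (T x) (T y)" for x y
    by (simp add: A_inner_def S_def AX cinner_commute[of "cadjoint T _"]
        flip: cadjoint[OF \<open>bounded_clinear T\<close>] cinner_commute)
  have symmetric: "A_inner A (S x) y = A_inner A x (S y)" for x y
    by (metis S_left A_inner_commute[OF A])
  have "bounded_linear S"
    unfolding S_def comp_def
    by (rule bounded_linear_compose[OF X.bounded_linear_axioms T.bounded_linear_axioms])
  then obtain K where K: "0 < K" "\<And>x. norm (S x) \<le> K * norm x"
    by (metis bounded_linear.pos_bounded mult.commute)
  have "A_norm A (T x) \<le> sqrt K * A_norm A x" for x
  proof -
    have "of_real ((A_norm A (T x))\<^sup>2) = A_inner A (S x) x"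
      by (simp add: S_left A_inner_self[OF A])
    then have "(A_norm A (T x))\<^sup>2 = cmod (A_inner A (S x) x)"
      by (metis norm_of_real abs_power2)
    also have "\<dots> \<le> A_norm A (S x) * A_norm A x"
      by (rule A_inner_Cauchy_Schwarz[OF A])
    also have "\<dots> \<le> K * A_norm A x * A_norm A x"
      by (intro mult_right_mono A_symmetric_bounded[OF A symmetric K(2,1)] A_norm_nonneg[OF A])
    also have "\<dots> = (sqrt K * A_norm A x)\<^sup>2"
      using K(1) by (simp add: power_mult_distrib power2_eq_square)
    finally show ?thesis
      by (rule power2_le_imp_le) (use K(1) A_norm_nonneg[OF A] in simp)
  qed
  moreover have "0 < sqrt K" using K(1) by simp
  ultimately show ?thesis
    using \<open>bounded_clinear T\<close> unfolding A_bounded_def by blast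
qed

section \<open>Operator seminorm and numerical radius\<close>

text \<open>The supremum only sees vectors of seminorm one. Vectors of seminorm zero cannot be normalized;
  boundedness in the seminorm sends them to vectors of seminorm zero.\<close>

lemma A_norm_le_A_opnorm:
  assumes A: "positive_op A" and T: "T \<in> A_bounded A"
  shows "A_norm A (T x) \<le> A_opnorm A T * A_norm A x"
proof -
  interpret bounded_clinear T using T by (simp add: A_bounded_def)
  obtain c where c: "\<And>x. A_norm A (T x) \<le> c * A_norm A x"
    using T by (auto simp: A_bounded_def)
  show ?thesis
  proof (cases "A_norm A x = 0")
    case True
    then show ?thesis using c[of x] by simp
  next
    case False
    then have pos: "0 < A_norm A x" using A_norm_nonneg[OF A, of x] by simp
    define y where "y = of_real (1 / A_norm A x) *\<^sub>C x"
    have y: "A_norm A y = 1"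
      using pos by (simp add: y_def A_norm_scaleC[OF A] norm_divide)
    have "A_norm A (T y) \<le> A_opnorm A T"
      unfolding A_opnorm_def
    proof (rule cSup_upper)
      show "A_norm A (T y) \<in> {A_norm A (T x) |x. A_norm A x = 1}" using y by blast
      show "bdd_above {A_norm A (T x) |x. A_norm A x = 1}"
      proof (rule bdd_aboveI[of _ c])
        fix r assume "r \<in> {A_norm A (T x) |x. A_norm A x = 1}"
        then obtain z where "r = A_norm A (T z)" "A_norm A z = 1" by blast
        then show "r \<le> c" using c[of z] by simp
      qed
    qed
    moreover have "A_norm A (T y) = A_norm A (T x) / A_norm A x"
      using pos by (simp add: y_def scaleC A_norm_scaleC[OF A] norm_divide)
    ultimately show ?thesis using pos by (simp add: field_simps)
  qed
qed

lemma A_numerical_range_bounded: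
  assumes A: "positive_op A" and T: "T \<in> A_bounded A"
  shows "cmod (A_inner A (T x) x) \<le> A_opnorm A T * (A_norm A x)\<^sup>2"
    and "bdd_above {cmod (A_inner A (T x) x) |x. A_norm A x = 1}"
proof -
  show *: "cmod (A_inner A (T x) x) \<le> A_opnorm A T * (A_norm A x)\<^sup>2" for x
  proof -
    have "cmod (A_inner A (T x) x) \<le> A_norm A (T x) * A_norm A x"
      by (rule A_inner_Cauchy_Schwarz[OF A])
    also have "\<dots> \<le> A_opnorm A T * A_norm A x * A_norm A x"
      by (intro mult_right_mono A_norm_le_A_opnorm[OF A T] A_norm_nonneg[OF A])
    finally show ?thesis by (simp add: power2_eq_square mult.assoc)
  qed
  show "bdd_above {cmod (A_inner A (T x) x) |x. A_norm A x = 1}"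
  proof (rule bdd_aboveI[of _ "A_opnorm A T"])
    fix r assume "r \<in> {cmod (A_inner A (T x) x) |x. A_norm A x = 1}"
    then obtain x where "r = cmod (A_inner A (T x) x)" "A_norm A x = 1" by blast
    then show "r \<le> A_opnorm A T" using *[of x] by simp
  qed
qed

lemma A_numradius_nonneg_le_A_opnorm:
  assumes A: "positive_op A" "A \<noteq> (\<lambda>_. 0)" and T: "T \<in> A_bounded A"
  shows "0 \<le> A_numradius A T" and "A_numradius A T \<le> A_opnorm A T"
proof -
  obtain u where u: "A_norm A u = 1" by (rule A_unit_vector_exists[OF A])
  have "cmod (A_inner A (T u) u) \<le> A_numradius A T"
    unfolding A_numradius_def
    by (rule cSup_upper[OF _ A_numerical_range_bounded(2)[OF A(1) T]]) (use u in blast)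
  then show "0 \<le> A_numradius A T" by (rule order_trans[OF norm_ge_zero])
  show "A_numradius A T \<le> A_opnorm A T"
    unfolding A_numradius_def
  proof (rule cSup_least)
    show "{cmod (A_inner A (T x) x) |x. A_norm A x = 1} \<noteq> {}" using u by blast
    fix r assume "r \<in> {cmod (A_inner A (T x) x) |x. A_norm A x = 1}"
    then obtain x where "r = cmod (A_inner A (T x) x)" "A_norm A x = 1" by blast
    then show "r \<le> A_opnorm A T" using A_numerical_range_bounded(1)[OF A(1) T, of x] by simp
  qed
qed

lemma A_inner_le_A_numradius:
  assumes A: "positive_op A" and T: "T \<in> A_bounded A"
  shows "cmod (A_inner A (T x) x) \<le> A_numradius A T * (A_norm A x)\<^sup>2"
proof (cases "A_norm A x = 0")
  case True
  then show ?thesis using A_numerical_range_bounded(1)[OF A T, of x] by simp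
next
  case False
  interpret bounded_clinear T using T by (simp add: A_bounded_def)
  have pos: "0 < A_norm A x" using False A_norm_nonneg[OF A, of x] by simp
  define y where "y = of_real (1 / A_norm A x) *\<^sub>C x"
  have y: "A_norm A y = 1"
    using pos by (simp add: y_def A_norm_scaleC[OF A] norm_divide)
  have "cmod (A_inner A (T y) y) \<le> A_numradius A T"
    unfolding A_numradius_def
    by (rule cSup_upper[OF _ A_numerical_range_bounded(2)[OF A T]]) (use y in blast)
  moreover have "cmod (A_inner A (T y) y) = cmod (A_inner A (T x) x) / (A_norm A x)\<^sup>2"
    using pos by (simp add: y_def scaleC A_inner_scaleC_left[OF A] A_inner_scaleC_right
        norm_mult norm_divide power2_eq_square)
  ultimately show ?thesis using pos by (simp add: field_simps)
qed

section \<open>Operator matrices\<close>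

lemma A_inner_diag_op:
  "A_inner (diag_op A) x y = (\<Sum>i\<in>UNIV. A_inner A (x $ i) (y $ i))"
proof -
  have "(\<Sum>j\<in>UNIV. (if i = j then A else (\<lambda>_. 0)) (x $ j)) = A (x $ i)" for i
    by (subst sum.remove[of _ i]) auto
  then show ?thesis
    by (simp add: A_inner_def diag_op_def op_matrix_def cinner_vec_def)
qed

lemma A_norm_diag_op:
  assumes "positive_op A"
  shows "A_norm (diag_op A) x = sqrt (\<Sum>i\<in>UNIV. (A_norm A (x $ i))\<^sup>2)"
  by (simp add: A_norm_def[of "diag_op A"] A_inner_diag_op A_inner_self[OF assms]
      flip: of_real_power)

text \<open>The sum over \<open>j \<noteq> i\<close> is estimated by \<open>u * v \<le> u\<^sup>2 / 4 + v\<^sup>2\<close> with \<open>v = a i * a j\<close>, the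
  diagonal part by the same inequality with \<open>v = (a i)\<^sup>2 - 1 / 2\<close>. The normalization makes the
  sum of all \<open>v\<^sup>2\<close> equal to \<open>(a i)\<^sup>2 * (1 - (a i)\<^sup>2) + ((a i)\<^sup>2 - 1 / 2)\<^sup>2 = 1 / 4\<close>.\<close>

lemma row_estimate:
  fixes a n :: "'d::finite \<Rightarrow> real" and w :: real
  assumes unit: "(\<Sum>j\<in>UNIV. (a j)\<^sup>2) = 1" and w: "0 \<le> w" "w \<le> n i"
  shows "w * (a i)\<^sup>2 + (\<Sum>j\<in>UNIV - {i}. n j * a i * a j)
    \<le> 1 / 2 * w + 1 / 4 * (1 + (\<Sum>j\<in>UNIV. (n j)\<^sup>2))"
proof -
  have young: "p * q \<le> p\<^sup>2 / 4 + q\<^sup>2" for p q :: real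
    using zero_le_power2[of "p / 2 - q"] by (simp add: power2_diff power_divide)
  have rest: "(\<Sum>j\<in>UNIV - {i}. (a j)\<^sup>2) = 1 - (a i)\<^sup>2"
    using unit by (simp add: sum.remove[of UNIV i])
  have "(\<Sum>j\<in>UNIV - {i}. n j * a i * a j) \<le> (\<Sum>j\<in>UNIV - {i}. (n j)\<^sup>2 / 4 + (a i * a j)\<^sup>2)"
    by (rule sum_mono) (use young[of "n _" "a i * a _"] in \<open>simp add: mult.assoc\<close>)
  also have "\<dots> = (\<Sum>j\<in>UNIV - {i}. (n j)\<^sup>2) / 4 + (a i)\<^sup>2 * (1 - (a i)\<^sup>2)"
    by (simp add: sum.distrib sum_divide_distrib power_mult_distrib flip: rest sum_distrib_left)
  finally have off: "(\<Sum>j\<in>UNIV - {i}. n j * a i * a j)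
      \<le> (\<Sum>j\<in>UNIV - {i}. (n j)\<^sup>2) / 4 + (a i)\<^sup>2 * (1 - (a i)\<^sup>2)" .
  have diag: "w * ((a i)\<^sup>2 - 1 / 2) \<le> (n i)\<^sup>2 / 4 + ((a i)\<^sup>2 - 1 / 2)\<^sup>2"
    using young[of w "(a i)\<^sup>2 - 1 / 2"] power_mono[OF w(2,1), of 2] by linarith
  have squares: "(a i)\<^sup>2 * (1 - (a i)\<^sup>2) + ((a i)\<^sup>2 - 1 / 2)\<^sup>2 = 1 / 4"
    by (simp add: power2_eq_square algebra_simps)
  have "(\<Sum>j\<in>UNIV. (n j)\<^sup>2) = (n i)\<^sup>2 + (\<Sum>j\<in>UNIV - {i}. (n j)\<^sup>2)"
    by (simp add: sum.remove[of UNIV i])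
  then show ?thesis using off diag squares by (simp add: algebra_simps)
qed

theorem theorem2p2:
  fixes A :: "'a::chilbert_space \<Rightarrow> 'a"
    and T :: "'d::finite \<Rightarrow> 'd \<Rightarrow> 'a \<Rightarrow> 'a"
  assumes nontrivial: "\<exists>x::'a. x \<noteq> 0"
    and A_positive: "positive_op A"
    and A_nonzero: "A \<noteq> (\<lambda>_. 0)"
    and T_adjointable: "\<And>i j. T i j \<in> A_adjointable A"
  shows "A_numradius (diag_op A) (op_matrix T)
    \<le> 1 / 2 * (\<Sum>i\<in>UNIV. A_numradius A (T i i))
      + 1 / 4 * (real CARD('d) + (\<Sum>i\<in>UNIV. \<Sum>j\<in>UNIV. (A_opnorm A (T i j))\<^sup>2))"
proof -
  note A = A_positive
  have T: "T i j \<in> A_bounded A" for i j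
    by (rule A_adjointable_imp_A_bounded[OF A T_adjointable])
  let ?w = "\<lambda>i. A_numradius A (T i i)" and ?n = "\<lambda>i j. A_opnorm A (T i j)"
  have bound: "cmod (A_inner (diag_op A) (op_matrix T x) x)
      \<le> 1 / 2 * (\<Sum>i\<in>UNIV. ?w i) + 1 / 4 * (real CARD('d) + (\<Sum>i\<in>UNIV. \<Sum>j\<in>UNIV. (?n i j)\<^sup>2))"
    if unit: "A_norm (diag_op A) x = 1" for x :: "'a ^ 'd"
  proof -
    define a where "a i = A_norm A (x $ i)" for i
    have a: "(\<Sum>i\<in>UNIV. (a i)\<^sup>2) = 1"
      using unit by (simp add: A_norm_diag_op[OF A] a_def)
    have row: "cmod (\<Sum>j\<in>UNIV. A_inner A (T i j (x $ j)) (x $ i))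
        \<le> 1 / 2 * ?w i + 1 / 4 * (1 + (\<Sum>j\<in>UNIV. (?n i j)\<^sup>2))" for i
    proof -
      have "cmod (\<Sum>j\<in>UNIV. A_inner A (T i j (x $ j)) (x $ i))
          \<le> (\<Sum>j\<in>UNIV. cmod (A_inner A (T i j (x $ j)) (x $ i)))"
        by (rule norm_sum)
      also have "\<dots> = cmod (A_inner A (T i i (x $ i)) (x $ i))
          + (\<Sum>j\<in>UNIV - {i}. cmod (A_inner A (T i j (x $ j)) (x $ i)))"
        by (simp add: sum.remove[of UNIV i])
      also have "\<dots> \<le> ?w i * (a i)\<^sup>2 + (\<Sum>j\<in>UNIV - {i}. ?n i j * a i * a j)"
      proof (intro add_mono sum_mono)
        show "cmod (A_inner A (T i i (x $ i)) (x $ i)) \<le> ?w i * (a i)\<^sup>2"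
          unfolding a_def by (rule A_inner_le_A_numradius[OF A T])
        show "cmod (A_inner A (T i j (x $ j)) (x $ i)) \<le> ?n i j * a i * a j" for j
        proof -
          have "cmod (A_inner A (T i j (x $ j)) (x $ i)) \<le> A_norm A (T i j (x $ j)) * a i"
            unfolding a_def by (rule A_inner_Cauchy_Schwarz[OF A])
          also have "\<dots> \<le> ?n i j * a j * a i"
            unfolding a_def
            by (intro mult_right_mono A_norm_le_A_opnorm[OF A T] A_norm_nonneg[OF A])
          finally show ?thesis by (simp add: mult_ac)
        qed
      qed
      also have "\<dots> \<le> 1 / 2 * ?w i + 1 / 4 * (1 + (\<Sum>j\<in>UNIV. (?n i j)\<^sup>2))"
        by (rule row_estimate[OF a A_numradius_nonneg_le_A_opnorm[OF A A_nonzero T]])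
      finally show ?thesis .
    qed
    have "cmod (A_inner (diag_op A) (op_matrix T x) x)
        = cmod (\<Sum>i\<in>UNIV. \<Sum>j\<in>UNIV. A_inner A (T i j (x $ j)) (x $ i))"
      by (simp add: A_inner_diag_op op_matrix_def A_inner_sum_left[OF A])
    also have "\<dots> \<le> (\<Sum>i\<in>UNIV. 1 / 2 * ?w i + 1 / 4 * (1 + (\<Sum>j\<in>UNIV. (?n i j)\<^sup>2)))"
      by (rule sum_norm_le[OF row])
    also have "\<dots> = 1 / 2 * (\<Sum>i\<in>UNIV. ?w i)
        + 1 / 4 * (real CARD('d) + (\<Sum>i\<in>UNIV. \<Sum>j\<in>UNIV. (?n i j)\<^sup>2))"
      by (simp add: sum.distrib flip: sum_distrib_left sum_divide_distrib)
    finally show ?thesis .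
  qed
  obtain u where u: "A_norm A u = 1" by (rule A_unit_vector_exists[OF A A_nonzero])
  have zero: "A_norm A 0 = 0" by (simp add: A_norm_def A_inner_def)
  \<comment> \<open>A unit vector in one coordinate shows that the supremum on the left has a nonempty range.\<close>
  define k :: 'd where "k = undefined"
  have "(\<Sum>i\<in>UNIV. (A_norm A (axis k u $ i))\<^sup>2) = (\<Sum>i\<in>UNIV. if i = k then 1 else 0)"
    by (rule sum.cong) (auto simp: axis_def u zero)
  then have "A_norm (diag_op A) (axis k u) = 1"
    by (simp add: A_norm_diag_op[OF A])
  then have "{cmod (A_inner (diag_op A) (op_matrix T x) x) |x. A_norm (diag_op A) x = 1} \<noteq> {}"
    by blast
  then show ?thesis
    unfolding A_numradius_def[of "diag_op A"] by (rule cSup_least) (use bound in blast)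
qed

end
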